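(* Let $\kappa$ be a cardinal. If $X$ is a set and $c:[X]^2\to\kappa$ is a maximal odd-cycle-free colouring into $\kappa$, then $|X|=2^\kappa$.
   Context: $[X]^2$ is the set of two-element subsets of $X$. A colouring $c:[X]^2\to\kappa$ is odd-cycle-free if there is no injective sequence $\langle x_i\mid i<k\rangle$ of elements of $X$, with $k\geq 3$ odd, such that $c$ is constant on $\{\{x_i,x_{i+1}\}\mid i+1<k\}\cup\{\{x_{k-1},x_0\}\}$. It is a maximal odd-cycle-free colouring into $\kappa$ if (1) $c$ is odd-cycle-free; and (2) for any proper superset $Y\supsetneq X$, no extension of $c$ to a colouring $c':[Y]^2\to\kappa$ is odd-cycle-free. *)

theory Defs
  imports "HOL-Library.Ramsey"
begin

unbundle cardinal_syntax

text \<open>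
  The set of two-element subsets of \<open>X\<close> is \<open>[X]\<^bsup>2\<^esup>\<close>, i.e. \<open>nsets X 2\<close>.
  Only the values \<open>c e\<close> for \<open>e\<close> in \<open>[X]\<^bsup>2\<^esup>\<close> are relevant for a colouring \<open>c\<close> on \<open>X\<close>.
\<close>

definition odd_cycle_free :: "'a set \<Rightarrow> ('a set \<Rightarrow> 'k) \<Rightarrow> bool" where
  "odd_cycle_free X c \<longleftrightarrow>
     \<not> (\<exists>(k::nat) (x :: nat \<Rightarrow> 'a).
          3 \<le> k \<and> odd k \<and> x \<in> {..<k} \<rightarrow> X \<and> inj_on x {..<k} \<and>
          (\<exists>d. \<forall>e \<in> {{x i, x (i + 1)} | i. i + 1 < k} \<union> {{x (k - 1), x 0}}. c e = d))"

text \<open>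
  A cardinal \<open>\<kappa>\<close> is a cardinal order; its elements (the colours) are the elements of \<open>Field \<kappa>\<close>.

  If proper supersets of \<open>X\<close> were taken inside \<open>'a\<close>, then every odd-cycle-free colouring
  on \<open>UNIV\<close> would count as maximal for lack of room. So \<open>X\<close> is identified with its copy
  \<open>Inl ` X\<close> in \<open>'a + 'b\<close>, and the supersets are taken there. The type \<open>'b\<close>, a source of
  new points, is an arbitrary parameter: maximality in the sense of set theory, where the
  superset is unrestricted, implies maximality for every choice of \<open>'b\<close>.
\<close>

definition maximal_odd_cycle_free ::
    "'b itself \<Rightarrow> 'k rel \<Rightarrow> 'a set \<Rightarrow> ('a set \<Rightarrow> 'k) \<Rightarrow> bool" where
  "maximal_odd_cycle_free (T :: 'b itself) \<kappa> X c \<longleftrightarrow>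
     odd_cycle_free X c \<and>
     (\<forall>Y :: ('a + 'b) set. Inl ` X \<subset> Y \<longrightarrow>
        \<not> (\<exists>c'. c' \<in> [Y]\<^bsup>2\<^esup> \<rightarrow> Field \<kappa> \<and>
               (\<forall>e \<in> [X]\<^bsup>2\<^esup>. c' (Inl ` e) = c e) \<and>
               odd_cycle_free Y c'))"

end

theory Submission imports Defs begin

text \<open>
  Every colour class of an odd-cycle-free colouring is a bipartite graph. Fixing a bipartition for
  each colour maps \<open>X\<close> into \<open>2\<^sup>\<kappa>\<close>, and this map is injective because two points joined by an edge of
  colour \<open>d\<close> are separated by the bipartition of \<open>d\<close>. If some \<open>g \<in> 2\<^sup>\<kappa>\<close> were not in its image, a new
  point with sides \<open>g\<close> could be added, each new edge getting a colour that separates its endpoints.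
\<close>

text \<open>A closed walk without repetition is itself a cycle. Otherwise a repeated vertex splits
  it into two shorter closed walks whose lengths add up to \<open>n\<close>, so one of them is odd;
  induct on the length.\<close>

lemma odd_closed_walk_contains_odd_cycle:
  assumes "irrefl R" "odd n" "w 0 = w n" "\<forall>i<n. (w i, w (Suc i)) \<in> R"
  obtains k x where "3 \<le> k" "odd k" "inj_on x {..<k}"
    "\<forall>i. Suc i < k \<longrightarrow> (x i, x (Suc i)) \<in> R" "(x (k - 1), x 0) \<in> R"
  using assms(2-)
proof (induction n arbitrary: w thesis rule: less_induct)
  case (less n)
  show ?case
  proof (cases "inj_on w {..<n}")
    case True
    \<comment> \<open>A walk of length 1 would be a loop, which irreflexivity excludes.\<close>
    have "n \<noteq> 1"
      using less.prems(3,4) assms(1) by (auto simp: irrefl_def)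
    moreover have "n \<noteq> 0" "n \<noteq> 2"
      using less.prems(2) by (auto elim: oddE)
    ultimately have "3 \<le> n" by linarith
    moreover have "(w (n - 1), w 0) \<in> R"
      using less.prems(3) less.prems(4)[rule_format, of "n - 1"] \<open>3 \<le> n\<close> by simp
    ultimately show ?thesis
      using less.prems True by (intro less.prems(1)[of n w]) auto
  next
    case False
    then obtain i j where ij: "i < j" "j < n" "w i = w j"
      unfolding inj_on_def by (metis lessThan_iff nat_neq_iff)
    show ?thesis
    proof (cases "odd (j - i)")
      case True
      show ?thesis
        by (rule less.IH[of "j - i" _ "\<lambda>m. w (i + m)"]) (use ij True less.prems in auto)
    next
      case False
      \<comment> \<open>The loop from \<open>i\<close> to \<open>j\<close> has even length here, so
        cutting it out leaves an odd closed walk. At the seam \<open>m = i\<close> the next step is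
        the one leaving \<open>w j\<close>, which equals \<open>w i\<close>.\<close>
      define v where "v m = (if m \<le> i then w m else w (m + (j - i)))" for m
      have "(v m, v (Suc m)) \<in> R" if "m < n - (j - i)" for m
      proof (cases "m = i")
        case True
        then show ?thesis
          using ij less.prems(4) by (auto simp: v_def)
      next
        case False
        then show ?thesis
          using that ij less.prems(4) by (auto simp: v_def)
      qed
      moreover have "v 0 = v (n - (j - i))"
        using ij less.prems(3) by (auto simp: v_def)
      moreover have "odd (n - (j - i))"
        using ij False less.prems(2) by auto
      moreover have "n - (j - i) < n"
        using ij by auto
      ultimately show ?thesis
        using less.IH[of "n - (j - i)" _ v] less.prems(1) by blast
    qed
  qed
qed

text \<open>Choose a root in each connected component and split the vertices by the parity of walks
  from the root. Two such walks of different parity to one vertex would form an odd closed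
  walk.\<close>

lemma bipartition_of_no_odd_closed_walk:
  assumes "sym R" and even_closed: "\<And>a n. (a, a) \<in> R ^^ n \<Longrightarrow> even n"
  obtains f :: "'a \<Rightarrow> bool" where "\<And>u v. (u, v) \<in> R \<Longrightarrow> f u \<noteq> f v"
proof
  define root where "root x = (SOME y. (x, y) \<in> R\<^sup>*)" for x
  define f where "f x \<longleftrightarrow> (\<exists>n. even n \<and> (root x, x) \<in> R ^^ n)" for x
  have sym_pow: "(b, a) \<in> R ^^ n" if "(a, b) \<in> R ^^ n" for a b n
    using that
  proof (induction n arbitrary: b)
    case (Suc n)
    then show ?case
      by (meson assms(1) relpow_Suc_E relpow_Suc_I2 symD)
  qed simp
  have reach: "\<exists>n. (root x, x) \<in> R ^^ n" for x
  proof -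
    have "(x, root x) \<in> R\<^sup>*"
      unfolding root_def by (rule someI[of _ x]) simp
    then show ?thesis
      using sym_pow rtrancl_imp_relpow by metis
  qed
  fix u v
  assume uv: "(u, v) \<in> R"
  then have vu: "(v, u) \<in> R"
    using assms(1) by (auto dest: symD)
  \<comment> \<open>Adjacent vertices reach the same vertices, so \<open>SOME\<close> is applied to
    the same predicate and returns the same root.\<close>
  have "(u, y) \<in> R\<^sup>* \<longleftrightarrow> (v, y) \<in> R\<^sup>*" for y
    using uv vu by (meson converse_rtrancl_into_rtrancl)
  then have root_eq: "root u = root v"
    by (simp add: root_def)
  obtain n where n: "(root u, u) \<in> R ^^ n"
    using reach by blast
  have step: "(root v, v) \<in> R ^^ Suc m" if "(root u, u) \<in> R ^^ m" for m
    using that uv root_eq by auto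
  show "f u \<noteq> f v"
  proof
    assume eq: "f u = f v"
    show False
    proof (cases "f u")
      case True
      then obtain m l where "even m" "even l" "(root u, u) \<in> R ^^ m" "(root v, v) \<in> R ^^ l"
        using eq by (auto simp: f_def)
      \<comment> \<open>Go to \<open>u\<close>, cross the edge to \<open>v\<close> and return to the
        common root: an odd closed walk.\<close>
      then have "(root v, root v) \<in> R ^^ (Suc m + l)"
        unfolding relpow_add using step sym_pow by blast
      then show False
        using even_closed \<open>even m\<close> \<open>even l\<close> by fastforce
    next
      case False
      \<comment> \<open>The walk to \<open>u\<close> is odd, so extending it by the edge gives an
        even walk to \<open>v\<close>.\<close>
      then show False
        using eq n step[OF n] unfolding f_def by (metis even_Suc)
    qed
  qed
qed

text \<open>Applies the equivalence of bipartite and odd-cycle-free to each colour class separately;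
  \<open>\<phi> x d\<close> is the side of \<open>x\<close> in the bipartition for colour
  \<open>d\<close>.\<close>

lemma odd_cycle_free_iff_bipartitions:
  "odd_cycle_free X c \<longleftrightarrow>
    (\<exists>\<phi>. \<forall>x\<in>X. \<forall>y\<in>X. x \<noteq> y \<longrightarrow> \<phi> x (c {x, y}) \<noteq> (\<phi> y (c {x, y}) :: bool))"
  (is "_ \<longleftrightarrow> ?bip")
proof
  assume free: "odd_cycle_free X c"
  have "\<exists>f. \<forall>x\<in>X. \<forall>y\<in>X. x \<noteq> y \<and> c {x, y} = d \<longrightarrow> f x \<noteq> (f y :: bool)" for d
  proof -
    define R where "R = {(x, y). x \<in> X \<and> y \<in> X \<and> x \<noteq> y \<and> c {x, y} = d}"
    have "irrefl R" "sym R"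
      by (auto simp: R_def irrefl_def sym_def insert_commute)
    have "even n" if closed: "(a, a) \<in> R ^^ n" for a n
    proof (rule ccontr)
      assume "odd n"
      obtain w where w: "w 0 = w n" "\<forall>i<n. (w i, w (Suc i)) \<in> R"
        using closed unfolding relpow_fun_conv by metis
      obtain k x where x: "3 \<le> k" "odd k" "inj_on x {..<k}"
          "\<forall>i. Suc i < k \<longrightarrow> (x i, x (Suc i)) \<in> R" "(x (k - 1), x 0) \<in> R"
        using odd_closed_walk_contains_odd_cycle[OF \<open>irrefl R\<close> \<open>odd n\<close> w] .
      \<comment> \<open>Every index is the source of an edge of the cycle, the last index being the
        source of the closing edge.\<close>
      have "x i \<in> X" if "i < k" for i
      proof (cases "Suc i < k")
        case True
        then show ?thesis
          using x(4) by (auto simp: R_def)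
      next
        case False
        then have "i = k - 1"
          using that by simp
        then show ?thesis
          using x(5) by (auto simp: R_def)
      qed
      moreover have "\<forall>e \<in> {{x i, x (i + 1)} | i. i + 1 < k} \<union> {{x (k - 1), x 0}}. c e = d"
        using x(4,5) by (auto simp: R_def)
      ultimately show False
        using free x(1-3) unfolding odd_cycle_free_def by blast
    qed
    then obtain f where "\<And>u v. (u, v) \<in> R \<Longrightarrow> f u \<noteq> (f v :: bool)"
      using bipartition_of_no_odd_closed_walk[OF \<open>sym R\<close>] by metis
    then show ?thesis
      unfolding R_def by blast
  qed
  then obtain F where "\<forall>d. \<forall>x\<in>X. \<forall>y\<in>X. x \<noteq> y \<and> c {x, y} = d \<longrightarrow> F d x \<noteq> (F d y :: bool)"
    by metis
  then show ?bip
    by (intro exI[of _ "\<lambda>x d. F d x"]) blast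
next
  assume ?bip
  then obtain \<phi> where \<phi>: "\<And>x y. \<lbrakk>x \<in> X; y \<in> X; x \<noteq> y\<rbrakk> \<Longrightarrow>
      \<phi> x (c {x, y}) \<noteq> (\<phi> y (c {x, y}) :: bool)"
    by blast
  show "odd_cycle_free X c"
    unfolding odd_cycle_free_def
  proof (rule notI, elim exE conjE)
    fix k :: nat and x d
    assume k: "3 \<le> k" "odd k" and x: "x \<in> {..<k} \<rightarrow> X" and inj: "inj_on x {..<k}"
      and d: "\<forall>e \<in> {{x i, x (i + 1)} | i. i + 1 < k} \<union> {{x (k - 1), x 0}}. c e = d"
    have edge: "\<phi> (x i) d \<noteq> \<phi> (x j) d" if "i < k" "j < k" "i \<noteq> j" "c {x i, x j} = d" for i j
      using \<phi>[of "x i" "x j"] that x inj by (auto simp: inj_on_def)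
    have alt: "\<phi> (x i) d \<longleftrightarrow> (\<phi> (x 0) d \<longleftrightarrow> even i)" if "i < k" for i
      using that
    proof (induction i)
      case (Suc i)
      have "c {x i, x (Suc i)} = d"
        using d Suc.prems by auto
      then show ?case
        using edge[of i "Suc i"] Suc by auto
    qed simp
    \<comment> \<open>Sides alternate along the cycle, so for odd \<open>k\<close> the closing edge
      joins two points on the same side.\<close>
    have "\<phi> (x (k - 1)) d \<noteq> \<phi> (x 0) d"
      using edge[of "k - 1" 0] k d by auto
    moreover have "even (k - 1)" "k - 1 < k"
      using k by auto
    ultimately show False
      using alt by blast
  qed
qed

theorem corollary3p7:
  fixes \<kappa> :: "'k rel" and X :: "'a set" and c :: "'a set \<Rightarrow> 'k"
  assumes "Card_order \<kappa>"
    and "c \<in> [X]\<^bsup>2\<^esup> \<rightarrow> Field \<kappa>"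
    and "maximal_odd_cycle_free TYPE('b) \<kappa> X c"
  shows "|X| =o ctwo ^c \<kappa>"
proof -
  have "odd_cycle_free X c"
    using assms(3) unfolding maximal_odd_cycle_free_def by (rule conjunct1)
  then obtain \<phi> where \<phi>: "\<And>x y. \<lbrakk>x \<in> X; y \<in> X; x \<noteq> y\<rbrakk> \<Longrightarrow>
      \<phi> x (c {x, y}) \<noteq> (\<phi> y (c {x, y}) :: bool)"
    unfolding odd_cycle_free_iff_bipartitions by blast
  \<comment> \<open>Elements of \<open>Func (Field \<kappa>) UNIV\<close> take the value
    \<open>undefined\<close> outside \<open>Field \<kappa>\<close>, hence this default.\<close>
  define \<psi> where "\<psi> x = (\<lambda>d. if d \<in> Field \<kappa> then \<phi> x d else undefined)" for x
  have col: "c {x, y} \<in> Field \<kappa>" if "x \<in> X" "y \<in> X" "x \<noteq> y" for x y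
  proof -
    have "{x, y} \<in> [X]\<^bsup>2\<^esup>"
      using that by (simp add: nsets_def)
    then show ?thesis
      using assms(2) by (rule funcset_mem[rotated])
  qed
  have "inj_on \<psi> X"
  proof (rule inj_onI, rule ccontr)
    fix x y
    assume xy: "x \<in> X" "y \<in> X" "\<psi> x = \<psi> y" "x \<noteq> y"
    then have "\<psi> x (c {x, y}) = \<psi> y (c {x, y})"
      by simp
    then show False
      using xy \<phi> col by (simp add: \<psi>_def)
  qed
  moreover have "\<psi> ` X = Func (Field \<kappa>) UNIV"
  proof
    show "\<psi> ` X \<subseteq> Func (Field \<kappa>) UNIV"
      by (auto simp: \<psi>_def Func_def)
    show "Func (Field \<kappa>) UNIV \<subseteq> \<psi> ` X"
    proof (rule subsetI, rule ccontr)
      fix g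
      assume g: "g \<in> Func (Field \<kappa>) UNIV" "g \<notin> \<psi> ` X"
      \<comment> \<open>Both \<open>\<psi> x\<close> and \<open>g\<close> are
        \<open>undefined\<close> off \<open>Field \<kappa>\<close>, so they differ at an actual
        colour. That colour can be given to the edge from \<open>x\<close> to the new point.\<close>
      have sep: "\<exists>d\<in>Field \<kappa>. \<phi> x d \<noteq> g d" if "x \<in> X" for x
      proof (rule ccontr)
        assume "\<not> ?thesis"
        then have "\<psi> x d = g d" for d
          using g(1) by (cases "d \<in> Field \<kappa>") (simp_all add: \<psi>_def Func_def)
        then have "\<psi> x = g"
          by (rule ext)
        then show False
          using g(2) that by blast
      qed
      \<comment> \<open>One new point suffices; \<open>Inr undefined\<close> is an arbitrary point
        outside the copy of \<open>X\<close>.\<close>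
      define Y :: "('a + 'b) set" where "Y = insert (Inr undefined) (Inl ` X)"
      define \<phi>' :: "'a + 'b \<Rightarrow> 'k \<Rightarrow> bool" where "\<phi>' = case_sum \<phi> (\<lambda>_. g)"
      \<comment> \<open>All demands on the colour of a single edge are collected here: it is a legal
        colour, it agrees with \<open>c\<close> on old edges, and it separates the endpoints under
        \<open>\<phi>'\<close>. Choosing such a colour for every edge then gives
        \<open>c'\<close>.\<close>
      have "\<exists>d. d \<in> Field \<kappa> \<and> (\<forall>e'\<in>[X]\<^bsup>2\<^esup>. e = Inl ` e' \<longrightarrow> d = c e') \<and>
          (\<forall>u\<in>e. \<forall>v\<in>e. u \<noteq> v \<longrightarrow> \<phi>' u d \<noteq> \<phi>' v d)" if eY: "e \<in> [Y]\<^bsup>2\<^esup>" for e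
      proof -
        obtain u v where e: "e = {u, v}" "u \<in> Y" "v \<in> Y" "u \<noteq> v"
          using eY unfolding nsets_def card_2_iff by blast
        consider x y where "x \<in> X" "y \<in> X" "x \<noteq> y" "e = {Inl x, Inl y}"
          | x where "x \<in> X" "e = {Inl x, Inr undefined}"
          using e unfolding Y_def by blast
        then show ?thesis
        proof cases
          case 1
          \<comment> \<open>\<open>Inl\<close> is injective, so agreement with \<open>c\<close>
            constrains the colour through one old edge only.\<close>
          have "e' = {x, y}" if "e = Inl ` e'" for e'
          proof -
            have "Inl ` e' = (Inl ` {x, y} :: ('a + 'b) set)"
              using that 1 by simp
            then show ?thesis
              by (metis inj_Inl inj_image_eq_iff)
          qed
          then show ?thesis
            using 1 \<phi> col by (intro exI[of _ "c {x, y}"]) (auto simp: \<phi>'_def)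
        next
          case 2
          obtain d where "d \<in> Field \<kappa>" "\<phi> x d \<noteq> g d"
            using sep 2 by blast
          then show ?thesis
            using 2 by (intro exI[of _ d]) (auto simp: \<phi>'_def)
        qed
      qed
      then have "\<forall>e\<in>[Y]\<^bsup>2\<^esup>. \<exists>d. d \<in> Field \<kappa> \<and> (\<forall>e'\<in>[X]\<^bsup>2\<^esup>. e = Inl ` e' \<longrightarrow> d = c e') \<and>
          (\<forall>u\<in>e. \<forall>v\<in>e. u \<noteq> v \<longrightarrow> \<phi>' u d \<noteq> \<phi>' v d)"
        by (rule ballI)
      from bchoice[OF this] obtain c' where c': "\<forall>e\<in>[Y]\<^bsup>2\<^esup>. c' e \<in> Field \<kappa> \<and>
          (\<forall>e'\<in>[X]\<^bsup>2\<^esup>. e = Inl ` e' \<longrightarrow> c' e = c e') \<and>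
          (\<forall>u\<in>e. \<forall>v\<in>e. u \<noteq> v \<longrightarrow> \<phi>' u (c' e) \<noteq> \<phi>' v (c' e))"
        by (rule exE)
      have c'_sep: "\<phi>' u (c' e) \<noteq> \<phi>' v (c' e)" if "e \<in> [Y]\<^bsup>2\<^esup>" "u \<in> e" "v \<in> e" "u \<noteq> v" for e u v
        using c'[THEN bspec, OF that(1)] that(2-) by blast
      have "Inl ` e \<in> [Y]\<^bsup>2\<^esup>" if "e \<in> [X]\<^bsup>2\<^esup>" for e
        using that by (auto simp: nsets_def Y_def card_image)
      then have "\<forall>e\<in>[X]\<^bsup>2\<^esup>. c' (Inl ` e) = c e"
        using c' by blast
      moreover have "\<phi>' u (c' {u, v}) \<noteq> \<phi>' v (c' {u, v})" if "u \<in> Y" "v \<in> Y" "u \<noteq> v" for u v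
      proof -
        have "{u, v} \<in> [Y]\<^bsup>2\<^esup>"
          using that by (simp add: nsets_def)
        then show ?thesis
          by (rule c'_sep) (use that in simp_all)
      qed
      then have "odd_cycle_free Y c'"
        unfolding odd_cycle_free_iff_bipartitions by blast
      moreover have "c' \<in> [Y]\<^bsup>2\<^esup> \<rightarrow> Field \<kappa>"
        using c' by blast
      moreover have "Inl ` X \<subset> Y"
        unfolding Y_def by blast
      ultimately show False
        using assms(3) unfolding maximal_odd_cycle_free_def by metis
    qed
  qed
  ultimately have "|X| =o |Func (Field \<kappa>) (UNIV :: bool set)|"
    unfolding card_of_ordIso[symmetric] bij_betw_def by blast
  then show ?thesis
    \<comment> \<open>\<open>ctwo\<close> is the cardinal of \<open>bool\<close>, so the power
      unfolds to the cardinal of this function space.\<close>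
    by (simp add: cexp_def ctwo_def Field_card_of)
qed

end
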